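(* For any context $\Gamma=(G,H)$ (as defined below), if a derivation in the range analysis calculus starting from $\Gamma$ reaches a context whose set of goals is empty, then every goal in $G$ holds under the hypotheses $H$, i.e. $H\models\gamma$ for all $\gamma\in G$.
   Context: Setting: formulas over sorts $\mathbb{F}_P$ ($P$ prime), $\mathbb{N}$ (with $+,\cdot$, truncated $-$, $\bmod$, $\le,\ge$, $\max$), $\mathrm{BV}_N$ and $\mathrm{Bool}$, with $\mathtt{ite}$ and conversions $\texttt{toNat}:\mathbb{F}_P\to\mathbb{N}$ (representative in $[0,P-1]$) and $\texttt{bvToNat}:\mathrm{BV}_N\to\mathbb{N}$. A context is $\Gamma=(G,H)$ with $G$ a finite set of goals ($\mathbb{N}$-inequalities) and $H$ a finite set of hypotheses; only $G$ is modified. Original variables are those occurring in $\Gamma$ before range analysis starts; placeholder variables $w,w_i$ are fresh variables introduced by the rules, implicitly existentially quantified over the whole goal set (the goal set means: there exist values of the placeholders making all goals true). $\mathrm{HasVars}(t)$ holds iff $t$ contains at least one variable and no placeholder variable; $\mathrm{twoOrigVars}(t)$ iff $t$ contains exactly two distinct non-placeholder variables; $\mathrm{hasSub}(t)$ iff $t$ contains $-_{\mathbb{N}}$. "Instantiate $w:=C$ using $\gamma$" means $G:=(G\setminus\{\gamma'\in G: w\text{ occurs in }\gamma'\})\cup\{\gamma'[w/C]:\gamma'\in G\setminus\{\gamma\}\}$. Rules ($t_i:\mathbb{N}$, $\gamma\in G$): introPVar: $\gamma\equiv t_1\bowtie t_2$, $\bowtie\in\{\le,\ge\}$, $\mathrm{HasVars}(t_1\bowtie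 t_2)$: replace $\gamma$ by $t_1\bowtie w$ and $t_2\bowtie' w$, $\bowtie'$ the other relation of $\{\le,\ge\}$. leqAddMul: $\gamma\equiv t_1\bowtie t_2\le w$, $\bowtie\in\{+,\cdot\}$, $\mathrm{HasVars}(t_1\bowtie t_2)$: replace by $t_1\le w_1$, $t_2\le w_2$, $w_1\bowtie w_2\le w$. leqSub: $\gamma\equiv t_1-t_2\le w$, $\mathrm{HasVars}(t_1-t_2)$: replace by $t_1\le w$. leqMod: $\gamma\equiv t_1\bmod t_2\le w$, $\mathrm{HasVars}(t_1\bmod t_2)$: replace by $t_2\le w$. leqIf: $\gamma\equiv\mathtt{ite}(c,t_1,t_2)\le w$, $\mathrm{HasVars}(t_1)$, $\mathrm{HasVars}(t_2)$: replace by $t_1\le w_1$, $t_2\le w_2$, $\max(w_1,w_2)\le w$. ineqHyp: $\gamma\equiv t_1\bowtie w$, $\bowtie\in\{\le,\ge\}$, $\mathrm{HasVars}(t_1)$, $t_1\bowtie C\in H$ for a constant $C$: instantiate $w:=C$. leqZMod: $\gamma\equiv\texttt{toNat}(v)\le w$, $v:\mathbb{F}_P$ not a placeholder: instantiate $w:=P-1$. leqBV: $\gamma\equiv\texttt{bvToNat}(v)\le w$, $v:\mathrm{BV}_N$ not a placeholder: instantiate $w:=2^N-1$. geNat: $\gamma\equiv t_1\ge w$, $\mathrm{HasVars}(t_1)$: instantiate $w:=0$. ineqConst: $\gamma\equiv C\bowtie w$, $C$ constant, and every $\gamma'\in G$ either does not contain $w$ or contains no original variable: instantiate $w:=C$.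 eval: $\gamma\equiv C_1\le C_2$ with constants: replace $\gamma$ by its evaluation (a true goal is thereby discharged). ineqCases: $\gamma\equiv t_1\bowtie t_2$, $\mathrm{twoOrigVars}(\gamma)$ with original variables $v_1,v_2$, $\mathrm{hasSub}(\gamma)$ or ($\mathrm{HasVars}(t_1)$ and $\mathrm{HasVars}(t_2)$), $v_1\le1\in H$, $v_2\le1\in H$: replace $\gamma$ by $\gamma[v_1,v_2/a,b]$ for all $(a,b)\in\{0,1\}^2$. ineqXOR: $\gamma\equiv v_1\cdot t_1+(1-v_1)\cdot t_2\bowtie w$, $\bowtie\in\{\le,\ge\}$, $v_1\le1\in H$: replace by $\mathtt{ite}(v_1=0,t_2,t_1)\bowtie w$.
   Formalization: The value of t mod 0, left open in the text, is fixed to be 0; under the usual convention t mod 0 = t the rule leqMod is unsound (the calculus would derive x mod 0 ≤ 0). For nonzero moduli mod is the ordinary remainder. *)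

theory Defs
  imports "HOL-Number_Theory.Residues"
begin

text \<open>
  The modulus of a field sort is prime by construction of this type, so that all expressions below
  are well-sorted and no separate sort check is needed.
\<close>

typedef prime_modulus = "{p :: nat. prime p}"
  morphisms modulus Abs_prime_modulus
  using two_is_prime_nat by blast

datatype rel = Le | Ge

fun other_rel :: "rel \<Rightarrow> rel" where
  "other_rel Le = Ge"
| "other_rel Ge = Le"

fun rel_holds :: "rel \<Rightarrow> nat \<Rightarrow> nat \<Rightarrow> bool" where
  "rel_holds Le a b \<longleftrightarrow> a \<le> b"
| "rel_holds Ge a b \<longleftrightarrow> a \<ge> b"

text \<open>
  The prime of a field term and the width of a bit-vector term are recorded once, at the place where
  the term is embedded into a natural-number term or a formula (\<open>ToNat P\<close>, \<open>FEq P\<close>, \<open>BvToNat N\<close>,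
  \<open>BvEq N\<close>). The operators of the field and bit-vector sorts play no role in the calculus.
\<close>

datatype nterm =
    NVar string | NConst nat
  | NAdd nterm nterm | NMul nterm nterm | NSub nterm nterm | NMod nterm nterm | NMax nterm nterm
  | NIte form nterm nterm
  | ToNat prime_modulus fterm | BvToNat nat bvterm
and fterm =
    FVar string | FConst int
  | FAdd fterm fterm | FMul fterm fterm | FSub fterm fterm | FNeg fterm
  | FIte form fterm fterm
and bvterm =
    BvVar string | BvConst nat
  | BvNot bvterm | BvAnd bvterm bvterm | BvOr bvterm bvterm | BvXor bvterm bvterm
  | BvAdd bvterm bvterm | BvMul bvterm bvterm | BvNeg bvterm
  | BvIte form bvterm bvterm
and form =
    BoolVar string | BoolConst bool
  | BNot form | BAnd form form | BOr form form | BImp form form | BIff form form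
  | BIte form form form
  | Ineq rel nterm nterm | NEq nterm nterm
  | FEq prime_modulus fterm fterm | BvEq nat bvterm bvterm

text \<open>Variables of different sorts are different, even if they have the same name.\<close>

datatype var = VNat string | VField prime_modulus string | VBv nat string | VBool string

primrec nvars :: "nterm \<Rightarrow> var set"
  and fvars :: "fterm \<Rightarrow> prime_modulus \<Rightarrow> var set"
  and bvvars :: "bvterm \<Rightarrow> nat \<Rightarrow> var set"
  and vars :: "form \<Rightarrow> var set" where
  "nvars (NVar x) = {VNat x}"
| "nvars (NConst c) = {}"
| "nvars (NAdd s t) = nvars s \<union> nvars t"
| "nvars (NMul s t) = nvars s \<union> nvars t"
| "nvars (NSub s t) = nvars s \<union> nvars t"
| "nvars (NMod s t) = nvars s \<union> nvars t"
| "nvars (NMax s t) = nvars s \<union> nvars t"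
| "nvars (NIte c s t) = vars c \<union> nvars s \<union> nvars t"
| "nvars (ToNat p u) = fvars u p"
| "nvars (BvToNat n b) = bvvars b n"
| "fvars (FVar x) = (\<lambda>p. {VField p x})"
| "fvars (FConst c) = (\<lambda>p. {})"
| "fvars (FAdd s t) = (\<lambda>p. fvars s p \<union> fvars t p)"
| "fvars (FMul s t) = (\<lambda>p. fvars s p \<union> fvars t p)"
| "fvars (FSub s t) = (\<lambda>p. fvars s p \<union> fvars t p)"
| "fvars (FNeg s) = (\<lambda>p. fvars s p)"
| "fvars (FIte c s t) = (\<lambda>p. vars c \<union> fvars s p \<union> fvars t p)"
| "bvvars (BvVar x) = (\<lambda>n. {VBv n x})"
| "bvvars (BvConst c) = (\<lambda>n. {})"
| "bvvars (BvNot s) = (\<lambda>n. bvvars s n)"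
| "bvvars (BvAnd s t) = (\<lambda>n. bvvars s n \<union> bvvars t n)"
| "bvvars (BvOr s t) = (\<lambda>n. bvvars s n \<union> bvvars t n)"
| "bvvars (BvXor s t) = (\<lambda>n. bvvars s n \<union> bvvars t n)"
| "bvvars (BvAdd s t) = (\<lambda>n. bvvars s n \<union> bvvars t n)"
| "bvvars (BvMul s t) = (\<lambda>n. bvvars s n \<union> bvvars t n)"
| "bvvars (BvNeg s) = (\<lambda>n. bvvars s n)"
| "bvvars (BvIte c s t) = (\<lambda>n. vars c \<union> bvvars s n \<union> bvvars t n)"
| "vars (BoolVar x) = {VBool x}"
| "vars (BoolConst b) = {}"
| "vars (BNot f) = vars f"
| "vars (BAnd f g) = vars f \<union> vars g"
| "vars (BOr f g) = vars f \<union> vars g"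
| "vars (BImp f g) = vars f \<union> vars g"
| "vars (BIff f g) = vars f \<union> vars g"
| "vars (BIte c f g) = vars c \<union> vars f \<union> vars g"
| "vars (Ineq r s t) = nvars s \<union> nvars t"
| "vars (NEq s t) = nvars s \<union> nvars t"
| "vars (FEq p u v) = fvars u p \<union> fvars v p"
| "vars (BvEq n b d) = bvvars b n \<union> bvvars d n"

text \<open>Only natural-number variables are ever substituted.\<close>

primrec nsubst :: "(string \<Rightarrow> nterm) \<Rightarrow> nterm \<Rightarrow> nterm"
  and fsubst :: "(string \<Rightarrow> nterm) \<Rightarrow> fterm \<Rightarrow> fterm"
  and bvsubst :: "(string \<Rightarrow> nterm) \<Rightarrow> bvterm \<Rightarrow> bvterm"
  and subst :: "(string \<Rightarrow> nterm) \<Rightarrow> form \<Rightarrow> form" where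
  "nsubst \<theta> (NVar x) = \<theta> x"
| "nsubst \<theta> (NConst c) = NConst c"
| "nsubst \<theta> (NAdd s t) = NAdd (nsubst \<theta> s) (nsubst \<theta> t)"
| "nsubst \<theta> (NMul s t) = NMul (nsubst \<theta> s) (nsubst \<theta> t)"
| "nsubst \<theta> (NSub s t) = NSub (nsubst \<theta> s) (nsubst \<theta> t)"
| "nsubst \<theta> (NMod s t) = NMod (nsubst \<theta> s) (nsubst \<theta> t)"
| "nsubst \<theta> (NMax s t) = NMax (nsubst \<theta> s) (nsubst \<theta> t)"
| "nsubst \<theta> (NIte c s t) = NIte (subst \<theta> c) (nsubst \<theta> s) (nsubst \<theta> t)"
| "nsubst \<theta> (ToNat p u) = ToNat p (fsubst \<theta> u)"
| "nsubst \<theta> (BvToNat n b) = BvToNat n (bvsubst \<theta> b)"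
| "fsubst \<theta> (FVar x) = FVar x"
| "fsubst \<theta> (FConst c) = FConst c"
| "fsubst \<theta> (FAdd s t) = FAdd (fsubst \<theta> s) (fsubst \<theta> t)"
| "fsubst \<theta> (FMul s t) = FMul (fsubst \<theta> s) (fsubst \<theta> t)"
| "fsubst \<theta> (FSub s t) = FSub (fsubst \<theta> s) (fsubst \<theta> t)"
| "fsubst \<theta> (FNeg s) = FNeg (fsubst \<theta> s)"
| "fsubst \<theta> (FIte c s t) = FIte (subst \<theta> c) (fsubst \<theta> s) (fsubst \<theta> t)"
| "bvsubst \<theta> (BvVar x) = BvVar x"
| "bvsubst \<theta> (BvConst c) = BvConst c"
| "bvsubst \<theta> (BvNot s) = BvNot (bvsubst \<theta> s)"
| "bvsubst \<theta> (BvAnd s t) = BvAnd (bvsubst \<theta> s) (bvsubst \<theta> t)"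
| "bvsubst \<theta> (BvOr s t) = BvOr (bvsubst \<theta> s) (bvsubst \<theta> t)"
| "bvsubst \<theta> (BvXor s t) = BvXor (bvsubst \<theta> s) (bvsubst \<theta> t)"
| "bvsubst \<theta> (BvAdd s t) = BvAdd (bvsubst \<theta> s) (bvsubst \<theta> t)"
| "bvsubst \<theta> (BvMul s t) = BvMul (bvsubst \<theta> s) (bvsubst \<theta> t)"
| "bvsubst \<theta> (BvNeg s) = BvNeg (bvsubst \<theta> s)"
| "bvsubst \<theta> (BvIte c s t) = BvIte (subst \<theta> c) (bvsubst \<theta> s) (bvsubst \<theta> t)"
| "subst \<theta> (BoolVar x) = BoolVar x"
| "subst \<theta> (BoolConst b) = BoolConst b"
| "subst \<theta> (BNot f) = BNot (subst \<theta> f)"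
| "subst \<theta> (BAnd f g) = BAnd (subst \<theta> f) (subst \<theta> g)"
| "subst \<theta> (BOr f g) = BOr (subst \<theta> f) (subst \<theta> g)"
| "subst \<theta> (BImp f g) = BImp (subst \<theta> f) (subst \<theta> g)"
| "subst \<theta> (BIff f g) = BIff (subst \<theta> f) (subst \<theta> g)"
| "subst \<theta> (BIte c f g) = BIte (subst \<theta> c) (subst \<theta> f) (subst \<theta> g)"
| "subst \<theta> (Ineq r s t) = Ineq r (nsubst \<theta> s) (nsubst \<theta> t)"
| "subst \<theta> (NEq s t) = NEq (nsubst \<theta> s) (nsubst \<theta> t)"
| "subst \<theta> (FEq p u v) = FEq p (fsubst \<theta> u) (fsubst \<theta> v)"
| "subst \<theta> (BvEq n b d) = BvEq n (bvsubst \<theta> b) (bvsubst \<theta> d)"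

primrec nhas_sub :: "nterm \<Rightarrow> bool"
  and fhas_sub :: "fterm \<Rightarrow> bool"
  and bvhas_sub :: "bvterm \<Rightarrow> bool"
  and has_sub :: "form \<Rightarrow> bool" where
  "nhas_sub (NVar x) = False"
| "nhas_sub (NConst c) = False"
| "nhas_sub (NAdd s t) = (nhas_sub s \<or> nhas_sub t)"
| "nhas_sub (NMul s t) = (nhas_sub s \<or> nhas_sub t)"
| "nhas_sub (NSub s t) = True"
| "nhas_sub (NMod s t) = (nhas_sub s \<or> nhas_sub t)"
| "nhas_sub (NMax s t) = (nhas_sub s \<or> nhas_sub t)"
| "nhas_sub (NIte c s t) = (has_sub c \<or> nhas_sub s \<or> nhas_sub t)"
| "nhas_sub (ToNat p u) = fhas_sub u"
| "nhas_sub (BvToNat n b) = bvhas_sub b"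
| "fhas_sub (FVar x) = False"
| "fhas_sub (FConst c) = False"
| "fhas_sub (FAdd s t) = (fhas_sub s \<or> fhas_sub t)"
| "fhas_sub (FMul s t) = (fhas_sub s \<or> fhas_sub t)"
| "fhas_sub (FSub s t) = (fhas_sub s \<or> fhas_sub t)"
| "fhas_sub (FNeg s) = fhas_sub s"
| "fhas_sub (FIte c s t) = (has_sub c \<or> fhas_sub s \<or> fhas_sub t)"
| "bvhas_sub (BvVar x) = False"
| "bvhas_sub (BvConst c) = False"
| "bvhas_sub (BvNot s) = bvhas_sub s"
| "bvhas_sub (BvAnd s t) = (bvhas_sub s \<or> bvhas_sub t)"
| "bvhas_sub (BvOr s t) = (bvhas_sub s \<or> bvhas_sub t)"
| "bvhas_sub (BvXor s t) = (bvhas_sub s \<or> bvhas_sub t)"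
| "bvhas_sub (BvAdd s t) = (bvhas_sub s \<or> bvhas_sub t)"
| "bvhas_sub (BvMul s t) = (bvhas_sub s \<or> bvhas_sub t)"
| "bvhas_sub (BvNeg s) = bvhas_sub s"
| "bvhas_sub (BvIte c s t) = (has_sub c \<or> bvhas_sub s \<or> bvhas_sub t)"
| "has_sub (BoolVar x) = False"
| "has_sub (BoolConst b) = False"
| "has_sub (BNot f) = has_sub f"
| "has_sub (BAnd f g) = (has_sub f \<or> has_sub g)"
| "has_sub (BOr f g) = (has_sub f \<or> has_sub g)"
| "has_sub (BImp f g) = (has_sub f \<or> has_sub g)"
| "has_sub (BIff f g) = (has_sub f \<or> has_sub g)"
| "has_sub (BIte c f g) = (has_sub c \<or> has_sub f \<or> has_sub g)"
| "has_sub (Ineq r s t) = (nhas_sub s \<or> nhas_sub t)"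
| "has_sub (NEq s t) = (nhas_sub s \<or> nhas_sub t)"
| "has_sub (FEq p u v) = (fhas_sub u \<or> fhas_sub v)"
| "has_sub (BvEq n b d) = (bvhas_sub b \<or> bvhas_sub d)"

text \<open>
  An element of \<open>F_P\<close> is an element of the carrier \<open>{0..P-1}\<close> of the residue ring; a bit vector of
  width \<open>N\<close> is a list of \<open>N\<close> bits, least significant bit first.
\<close>

abbreviation FF :: "prime_modulus \<Rightarrow> int ring" where
  "FF p \<equiv> residue_ring (int (modulus p))"

definition bv_to_nat :: "bool list \<Rightarrow> nat" where
  "bv_to_nat bs = horner_sum of_bool 2 bs"

definition bv_of_nat :: "nat \<Rightarrow> nat \<Rightarrow> bool list" where
  "bv_of_nat n k = map (bit k) [0..<n]"

text \<open>
  The remainder modulo zero is fixed to be zero, so that \<open>t\<^sub>1 mod t\<^sub>2 \<le> t\<^sub>2\<close> holds throughout.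
  Under the convention \<open>a mod 0 = a\<close> of HOL the calculus is unsound: it derives \<open>x mod 0 \<le> 0\<close>.
\<close>

definition nat_mod :: "nat \<Rightarrow> nat \<Rightarrow> nat" where
  "nat_mod a b = (if b = 0 then 0 else a mod b)"

record valuation =
  nat_val :: "string \<Rightarrow> nat"
  field_val :: "prime_modulus \<Rightarrow> string \<Rightarrow> int"
  bv_val :: "nat \<Rightarrow> string \<Rightarrow> bool list"
  bool_val :: "string \<Rightarrow> bool"

definition well_sorted :: "valuation \<Rightarrow> bool" where
  "well_sorted M \<longleftrightarrow>
     (\<forall>p x. field_val M p x \<in> carrier (FF p)) \<and> (\<forall>n x. length (bv_val M n x) = n)"

primrec neval :: "valuation \<Rightarrow> nterm \<Rightarrow> nat"
  and feval :: "valuation \<Rightarrow> fterm \<Rightarrow> prime_modulus \<Rightarrow> int"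
  and bveval :: "valuation \<Rightarrow> bvterm \<Rightarrow> nat \<Rightarrow> bool list"
  and holds :: "valuation \<Rightarrow> form \<Rightarrow> bool" where
  "neval M (NVar x) = nat_val M x"
| "neval M (NConst c) = c"
| "neval M (NAdd s t) = neval M s + neval M t"
| "neval M (NMul s t) = neval M s * neval M t"
| "neval M (NSub s t) = neval M s - neval M t"
| "neval M (NMod s t) = nat_mod (neval M s) (neval M t)"
| "neval M (NMax s t) = max (neval M s) (neval M t)"
| "neval M (NIte c s t) = (if holds M c then neval M s else neval M t)"
| "neval M (ToNat p u) = nat (feval M u p)"
| "neval M (BvToNat n b) = bv_to_nat (bveval M b n)"
| "feval M (FVar x) = (\<lambda>p. field_val M p x)"
| "feval M (FConst c) = (\<lambda>p. c mod int (modulus p))"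
| "feval M (FAdd s t) = (\<lambda>p. feval M s p \<oplus>\<^bsub>FF p\<^esub> feval M t p)"
| "feval M (FMul s t) = (\<lambda>p. feval M s p \<otimes>\<^bsub>FF p\<^esub> feval M t p)"
| "feval M (FSub s t) = (\<lambda>p. feval M s p \<ominus>\<^bsub>FF p\<^esub> feval M t p)"
| "feval M (FNeg s) = (\<lambda>p. \<ominus>\<^bsub>FF p\<^esub> feval M s p)"
| "feval M (FIte c s t) = (\<lambda>p. if holds M c then feval M s p else feval M t p)"
| "bveval M (BvVar x) = (\<lambda>n. bv_val M n x)"
| "bveval M (BvConst c) = (\<lambda>n. bv_of_nat n c)"
| "bveval M (BvNot s) = (\<lambda>n. map Not (bveval M s n))"
| "bveval M (BvAnd s t) = (\<lambda>n. map2 (\<and>) (bveval M s n) (bveval M t n))"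
| "bveval M (BvOr s t) = (\<lambda>n. map2 (\<or>) (bveval M s n) (bveval M t n))"
| "bveval M (BvXor s t) = (\<lambda>n. map2 (\<noteq>) (bveval M s n) (bveval M t n))"
| "bveval M (BvAdd s t) =
     (\<lambda>n. bv_of_nat n (bv_to_nat (bveval M s n) + bv_to_nat (bveval M t n)))"
| "bveval M (BvMul s t) =
     (\<lambda>n. bv_of_nat n (bv_to_nat (bveval M s n) * bv_to_nat (bveval M t n)))"
| "bveval M (BvNeg s) = (\<lambda>n. bv_of_nat n (2 ^ n - bv_to_nat (bveval M s n)))"
| "bveval M (BvIte c s t) = (\<lambda>n. if holds M c then bveval M s n else bveval M t n)"
| "holds M (BoolVar x) = bool_val M x"
| "holds M (BoolConst b) = b"
| "holds M (BNot f) = (\<not> holds M f)"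
| "holds M (BAnd f g) = (holds M f \<and> holds M g)"
| "holds M (BOr f g) = (holds M f \<or> holds M g)"
| "holds M (BImp f g) = (holds M f \<longrightarrow> holds M g)"
| "holds M (BIff f g) = (holds M f \<longleftrightarrow> holds M g)"
| "holds M (BIte c f g) = (if holds M c then holds M f else holds M g)"
| "holds M (Ineq r s t) = rel_holds r (neval M s) (neval M t)"
| "holds M (NEq s t) = (neval M s = neval M t)"
| "holds M (FEq p u v) = (feval M u p = feval M v p)"
| "holds M (BvEq n b d) = (bveval M b n = bveval M d n)"

definition entails :: "form set \<Rightarrow> form \<Rightarrow> bool" where
  "entails H \<gamma> \<longleftrightarrow> (\<forall>M. well_sorted M \<and> (\<forall>h\<in>H. holds M h) \<longrightarrow> holds M \<gamma>)"

type_synonym ctxt = "form set \<times> form set"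

definition is_context :: "ctxt \<Rightarrow> bool" where
  "is_context \<Gamma> \<longleftrightarrow>
     finite (fst \<Gamma>) \<and> finite (snd \<Gamma>) \<and> (\<forall>\<gamma>\<in>fst \<Gamma>. \<exists>r t\<^sub>1 t\<^sub>2. \<gamma> = Ineq r t\<^sub>1 t\<^sub>2)"

definition ctxt_vars :: "ctxt \<Rightarrow> var set" where
  "ctxt_vars \<Gamma> = \<Union> (vars ` (fst \<Gamma> \<union> snd \<Gamma>))"

text \<open>
  Below, \<open>V\<close> is the set of original variables, that is, the variables of the context in which the
  derivation starts. Every other variable is a placeholder; placeholders are of natural-number sort.
  A constant is a variable-free term: instantiation produces terms such as \<open>3 + 4\<close>, which the rules
  for constants have to handle.
\<close>

definition placeholder :: "var set \<Rightarrow> string \<Rightarrow> bool" where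
  "placeholder V w \<longleftrightarrow> VNat w \<notin> V"

definition fresh :: "var set \<Rightarrow> ctxt \<Rightarrow> string \<Rightarrow> bool" where
  "fresh V \<Gamma> w \<longleftrightarrow> VNat w \<notin> V \<and> VNat w \<notin> ctxt_vars \<Gamma>"

definition has_vars :: "var set \<Rightarrow> var set \<Rightarrow> bool" where
  "has_vars V X \<longleftrightarrow> X \<noteq> {} \<and> X \<subseteq> V"

definition const :: "nterm \<Rightarrow> bool" where
  "const t \<longleftrightarrow> nvars t = {}"

definition evaluates_to :: "form \<Rightarrow> bool \<Rightarrow> bool" where
  "evaluates_to \<gamma> b \<longleftrightarrow> (\<forall>M. well_sorted M \<longrightarrow> holds M \<gamma> = b)"

definition replace :: "form set \<Rightarrow> form \<Rightarrow> form set \<Rightarrow> form set" where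
  "replace G \<gamma> A = (G - {\<gamma>}) \<union> A"

definition instantiate :: "form set \<Rightarrow> form \<Rightarrow> string \<Rightarrow> nterm \<Rightarrow> form set" where
  "instantiate G \<gamma> w C =
     (G - {\<gamma>' \<in> G. VNat w \<in> vars \<gamma>'}) \<union> subst (NVar(w := C)) ` (G - {\<gamma>})"

inductive ra_step :: "var set \<Rightarrow> ctxt \<Rightarrow> ctxt \<Rightarrow> bool" for V :: "var set" where
  introPVar:
  "\<lbrakk>\<gamma> \<in> G; \<gamma> = Ineq r t\<^sub>1 t\<^sub>2; has_vars V (vars \<gamma>); fresh V (G, H) w\<rbrakk>
   \<Longrightarrow> ra_step V (G, H)
         (replace G \<gamma> {Ineq r t\<^sub>1 (NVar w), Ineq (other_rel r) t\<^sub>2 (NVar w)}, H)"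
| leqAddMul:
  "\<lbrakk>\<gamma> \<in> G; f = NAdd \<or> f = NMul; \<gamma> = Ineq Le (f t\<^sub>1 t\<^sub>2) (NVar w); placeholder V w;
    has_vars V (nvars (f t\<^sub>1 t\<^sub>2)); fresh V (G, H) w\<^sub>1; fresh V (G, H) w\<^sub>2; w\<^sub>1 \<noteq> w\<^sub>2\<rbrakk>
   \<Longrightarrow> ra_step V (G, H)
         (replace G \<gamma> {Ineq Le t\<^sub>1 (NVar w\<^sub>1), Ineq Le t\<^sub>2 (NVar w\<^sub>2),
                        Ineq Le (f (NVar w\<^sub>1) (NVar w\<^sub>2)) (NVar w)}, H)"
| leqSub:
  "\<lbrakk>\<gamma> \<in> G; \<gamma> = Ineq Le (NSub t\<^sub>1 t\<^sub>2) (NVar w); placeholder V w; has_vars V (nvars (NSub t\<^sub>1 t\<^sub>2))\<rbrakk>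
   \<Longrightarrow> ra_step V (G, H) (replace G \<gamma> {Ineq Le t\<^sub>1 (NVar w)}, H)"
| leqMod:
  "\<lbrakk>\<gamma> \<in> G; \<gamma> = Ineq Le (NMod t\<^sub>1 t\<^sub>2) (NVar w); placeholder V w; has_vars V (nvars (NMod t\<^sub>1 t\<^sub>2))\<rbrakk>
   \<Longrightarrow> ra_step V (G, H) (replace G \<gamma> {Ineq Le t\<^sub>2 (NVar w)}, H)"
| leqIf:
  "\<lbrakk>\<gamma> \<in> G; \<gamma> = Ineq Le (NIte c t\<^sub>1 t\<^sub>2) (NVar w); placeholder V w;
    has_vars V (nvars t\<^sub>1); has_vars V (nvars t\<^sub>2);
    fresh V (G, H) w\<^sub>1; fresh V (G, H) w\<^sub>2; w\<^sub>1 \<noteq> w\<^sub>2\<rbrakk>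
   \<Longrightarrow> ra_step V (G, H)
         (replace G \<gamma> {Ineq Le t\<^sub>1 (NVar w\<^sub>1), Ineq Le t\<^sub>2 (NVar w\<^sub>2),
                        Ineq Le (NMax (NVar w\<^sub>1) (NVar w\<^sub>2)) (NVar w)}, H)"
| ineqHyp:
  "\<lbrakk>\<gamma> \<in> G; \<gamma> = Ineq r t\<^sub>1 (NVar w); placeholder V w; has_vars V (nvars t\<^sub>1);
    Ineq r t\<^sub>1 C \<in> H; const C\<rbrakk>
   \<Longrightarrow> ra_step V (G, H) (instantiate G \<gamma> w C, H)"
| leqZMod:
  "\<lbrakk>\<gamma> \<in> G; \<gamma> = Ineq Le (ToNat p (FVar v)) (NVar w); placeholder V w; VField p v \<in> V\<rbrakk>
   \<Longrightarrow> ra_step V (G, H) (instantiate G \<gamma> w (NConst (modulus p - 1)), H)"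
| leqBV:
  "\<lbrakk>\<gamma> \<in> G; \<gamma> = Ineq Le (BvToNat n (BvVar v)) (NVar w); placeholder V w; VBv n v \<in> V\<rbrakk>
   \<Longrightarrow> ra_step V (G, H) (instantiate G \<gamma> w (NConst (2 ^ n - 1)), H)"
| geNat:
  "\<lbrakk>\<gamma> \<in> G; \<gamma> = Ineq Ge t\<^sub>1 (NVar w); placeholder V w; has_vars V (nvars t\<^sub>1)\<rbrakk>
   \<Longrightarrow> ra_step V (G, H) (instantiate G \<gamma> w (NConst 0), H)"
| ineqConst:
  "\<lbrakk>\<gamma> \<in> G; \<gamma> = Ineq r C (NVar w); placeholder V w; const C;
    \<forall>\<gamma>'\<in>G. VNat w \<notin> vars \<gamma>' \<or> vars \<gamma>' \<inter> V = {}\<rbrakk>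
   \<Longrightarrow> ra_step V (G, H) (instantiate G \<gamma> w C, H)"
| eval:
  "\<lbrakk>\<gamma> \<in> G; \<gamma> = Ineq r C\<^sub>1 C\<^sub>2; const C\<^sub>1; const C\<^sub>2; evaluates_to \<gamma> b\<rbrakk>
   \<Longrightarrow> ra_step V (G, H) (replace G \<gamma> (if b then {} else {BoolConst False}), H)"
| ineqCases:
  "\<lbrakk>\<gamma> \<in> G; \<gamma> = Ineq r t\<^sub>1 t\<^sub>2; vars \<gamma> \<inter> V = {VNat v\<^sub>1, VNat v\<^sub>2}; v\<^sub>1 \<noteq> v\<^sub>2;
    has_sub \<gamma> \<or> (has_vars V (nvars t\<^sub>1) \<and> has_vars V (nvars t\<^sub>2));
    Ineq Le (NVar v\<^sub>1) (NConst 1) \<in> H; Ineq Le (NVar v\<^sub>2) (NConst 1) \<in> H\<rbrakk>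
   \<Longrightarrow> ra_step V (G, H)
         (replace G \<gamma>
            {subst (NVar(v\<^sub>1 := NConst a, v\<^sub>2 := NConst b)) \<gamma> |a b. a \<in> {0, 1} \<and> b \<in> {0, 1}}, H)"
| ineqXOR:
  "\<lbrakk>\<gamma> \<in> G;
    \<gamma> = Ineq r (NAdd (NMul (NVar v\<^sub>1) t\<^sub>1) (NMul (NSub (NConst 1) (NVar v\<^sub>1)) t\<^sub>2)) (NVar w);
    placeholder V w; Ineq Le (NVar v\<^sub>1) (NConst 1) \<in> H\<rbrakk>
   \<Longrightarrow> ra_step V (G, H)
         (replace G \<gamma> {Ineq r (NIte (NEq (NVar v\<^sub>1) (NConst 0)) t\<^sub>2 t\<^sub>1) (NVar w)}, H)"

end

theory Submission
  imports Defs
begin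

text \<open>
  Every rule is sound read backwards: if, in a fixed model of the hypotheses, the placeholders can be
  given values making the new goals true, then they can be given values making the old goals true.
  For the structural rules the same values work; for an instantiation \<open>w := C\<close> the placeholder \<open>w\<close>
  receives the value of \<open>C\<close>. The empty goal set is trivially satisfiable, and the initial goals
  contain no placeholders, so they hold in the model itself.
\<close>

text \<open>Reduces substitution to a change of the natural-number valuation, so that instantiating
  a placeholder becomes choosing its value. The four syntactic classes are mutually recursive, hence
  one joint induction.\<close>

lemma eval_subst:
  shows "neval M (nsubst \<theta> t) = neval (M\<lparr>nat_val := \<lambda>x. neval M (\<theta> x)\<rparr>) t"
    and "feval M (fsubst \<theta> u) = feval (M\<lparr>nat_val := \<lambda>x. neval M (\<theta> x)\<rparr>) u"
    and "bveval M (bvsubst \<theta> b) = bveval (M\<lparr>nat_val := \<lambda>x. neval M (\<theta> x)\<rparr>) b"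
    and "holds M (subst \<theta> f) = holds (M\<lparr>nat_val := \<lambda>x. neval M (\<theta> x)\<rparr>) f"
  by (induction t and u and b and f) (simp_all cong: if_cong)

text \<open>Coincidence lemma. Both valuations extend the same \<open>M\<close>, so only variables
  of natural-number sort can make a difference.\<close>

lemma eval_cong:
  shows "(\<And>x. VNat x \<in> nvars t \<Longrightarrow> g x = h x) \<Longrightarrow>
           neval (M\<lparr>nat_val := g\<rparr>) t = neval (M\<lparr>nat_val := h\<rparr>) t"
    and "(\<And>x. VNat x \<in> fvars u p \<Longrightarrow> g x = h x) \<Longrightarrow>
           feval (M\<lparr>nat_val := g\<rparr>) u p = feval (M\<lparr>nat_val := h\<rparr>) u p"
    and "(\<And>x. VNat x \<in> bvvars b n \<Longrightarrow> g x = h x) \<Longrightarrow>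
           bveval (M\<lparr>nat_val := g\<rparr>) b n = bveval (M\<lparr>nat_val := h\<rparr>) b n"
    and "(\<And>x. VNat x \<in> vars f \<Longrightarrow> g x = h x) \<Longrightarrow>
           holds (M\<lparr>nat_val := g\<rparr>) f = holds (M\<lparr>nat_val := h\<rparr>) f"
  by (induction t and u and b and f arbitrary: and p and n and) simp_all

lemma neval_cong_upd:
  "VNat w \<notin> nvars t \<Longrightarrow> neval (M\<lparr>nat_val := g(w := a)\<rparr>) t = neval (M\<lparr>nat_val := g\<rparr>) t"
  by (rule eval_cong) auto

lemma bv_to_nat_le: "bv_to_nat bs \<le> 2 ^ length bs - 1"
proof -
  have "bv_to_nat bs < 2 ^ length bs"
    unfolding bv_to_nat_def by (rule horner_sum_of_bool_2_less)
  then show ?thesis by simp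
qed

text \<open>Encodes the implicit existential quantifier over placeholders: \<open>g\<close> is free
  outside \<open>V\<close>, and a single \<open>g\<close> must serve all goals because they may
  share placeholders.\<close>

definition satisfiable :: "var set \<Rightarrow> valuation \<Rightarrow> form set \<Rightarrow> bool" where
  "satisfiable V M G \<longleftrightarrow>
     (\<exists>g. (\<forall>x. VNat x \<in> V \<longrightarrow> g x = nat_val M x) \<and> (\<forall>\<gamma>\<in>G. holds (M\<lparr>nat_val := g\<rparr>) \<gamma>))"

lemma satisfiable_holds:
  assumes "satisfiable V M G" and "\<gamma> \<in> G" and "vars \<gamma> \<subseteq> V"
  shows "holds M \<gamma>"
proof -
  obtain g where g: "\<And>x. VNat x \<in> V \<Longrightarrow> g x = nat_val M x" "holds (M\<lparr>nat_val := g\<rparr>) \<gamma>"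
    using assms by (auto simp: satisfiable_def)
  have "holds (M\<lparr>nat_val := nat_val M\<rparr>) \<gamma>"
    using g assms(3) eval_cong(4)[of \<gamma> g "nat_val M" M] by blast
  then show ?thesis by simp
qed

text \<open>For the structural rules: the witness \<open>g\<close> is kept. The implication may rely
  on agreement with \<open>M\<close> on \<open>V\<close>, which gives access to facts about original
  variables.\<close>

lemma satisfiable_replace:
  assumes "satisfiable V M (replace G \<gamma> A)"
    and "\<And>g. \<lbrakk>\<And>x. VNat x \<in> V \<Longrightarrow> g x = nat_val M x; \<forall>\<delta>\<in>A. holds (M\<lparr>nat_val := g\<rparr>) \<delta>\<rbrakk>
           \<Longrightarrow> holds (M\<lparr>nat_val := g\<rparr>) \<gamma>"
  shows "satisfiable V M G"
proof -
  obtain g where g: "\<forall>x. VNat x \<in> V \<longrightarrow> g x = nat_val M x"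
      "\<forall>\<delta>\<in>(G - {\<gamma>}) \<union> A. holds (M\<lparr>nat_val := g\<rparr>) \<delta>"
    using assms(1) by (auto simp: satisfiable_def replace_def)
  with assms(2)[of g] have "\<forall>\<delta>\<in>G. holds (M\<lparr>nat_val := g\<rparr>) \<delta>"
    by blast
  with g(1) show ?thesis by (auto simp: satisfiable_def)
qed

text \<open>The new witness sends \<open>w\<close> to the value of \<open>C\<close>. The removed
  goal then holds by \<open>bound\<close>, and every other goal by the substitution lemma.\<close>

lemma satisfiable_instantiate:
  assumes "satisfiable V M (instantiate G (Ineq r t (NVar w)) w C)"
    and w: "placeholder V w" "VNat w \<notin> nvars t"
    and bound: "\<And>g. (\<And>x. VNat x \<in> V \<Longrightarrow> g x = nat_val M x) \<Longrightarrow>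
      rel_holds r (neval (M\<lparr>nat_val := g\<rparr>) t) (neval (M\<lparr>nat_val := g\<rparr>) C)"
  shows "satisfiable V M G"
proof -
  obtain g where agree: "\<And>x. VNat x \<in> V \<Longrightarrow> g x = nat_val M x"
    and sat: "\<And>\<delta>. \<delta> \<in> instantiate G (Ineq r t (NVar w)) w C \<Longrightarrow> holds (M\<lparr>nat_val := g\<rparr>) \<delta>"
    using assms(1) by (auto simp: satisfiable_def)
  define h where "h = g(w := neval (M\<lparr>nat_val := g\<rparr>) C)"
  have eq: "(\<lambda>x. neval (M\<lparr>nat_val := g\<rparr>) ((NVar(w := C)) x)) = h"
    by (auto simp: h_def)
  have "holds (M\<lparr>nat_val := h\<rparr>) \<delta>" if "\<delta> \<in> G" for \<delta>
  proof (cases "\<delta> = Ineq r t (NVar w)")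
    case True
    then show ?thesis
      using bound[OF agree] w(2) by (simp add: h_def neval_cong_upd)
  next
    case False
    \<comment> \<open>The image under \<open>subst\<close> ranges over all goals except the
      principal one, so goals with and without \<open>w\<close> are treated alike.\<close>
    then have "holds (M\<lparr>nat_val := g\<rparr>) (subst (NVar(w := C)) \<delta>)"
      using that by (intro sat) (auto simp: instantiate_def)
    then show ?thesis
      unfolding eval_subst(4) eq by simp
  qed
  moreover have "h x = nat_val M x" if "VNat x \<in> V" for x
    using that w(1) agree by (auto simp: h_def placeholder_def)
  ultimately show ?thesis by (auto simp: satisfiable_def)
qed

lemma ra_step_sound:
  assumes step: "ra_step V (G, H) (G', H')"
    and M: "well_sorted M" and H: "\<And>h. h \<in> H \<Longrightarrow> holds M h" "\<And>h. h \<in> H \<Longrightarrow> vars h \<subseteq> V"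
    and sat: "satisfiable V M G'"
  shows "satisfiable V M G"
proof -
  \<comment> \<open>Hypotheses mention original variables only, so reassigning placeholders keeps
    them true.\<close>
  have hyp: "holds (M\<lparr>nat_val := g\<rparr>) h"
    if "\<And>x. VNat x \<in> V \<Longrightarrow> g x = nat_val M x" "h \<in> H" for g h
    using H[OF that(2)] that(1) eval_cong(4)[of h g "nat_val M" M] by auto
  have le_one: "nat_val M v \<le> 1" "VNat v \<in> V" if "Ineq Le (NVar v) (NConst 1) \<in> H" for v
    using H[OF that] by auto
  from step show ?thesis
  proof cases
    case (introPVar \<gamma> r t\<^sub>1 t\<^sub>2 w)
    show ?thesis
      using sat unfolding introPVar(1,4) by (rule satisfiable_replace) (cases r; simp)
  next
    case (leqAddMul \<gamma> f t\<^sub>1 t\<^sub>2 w w\<^sub>1 w\<^sub>2)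
    have G': "satisfiable V M (replace G \<gamma> {Ineq Le t\<^sub>1 (NVar w\<^sub>1), Ineq Le t\<^sub>2 (NVar w\<^sub>2),
        Ineq Le (f (NVar w\<^sub>1) (NVar w\<^sub>2)) (NVar w)})"
      using sat leqAddMul by simp
    show ?thesis
    proof (rule satisfiable_replace[OF G'], goal_cases)
      case (1 g)
      have "g w\<^sub>1 \<ge> neval (M\<lparr>nat_val := g\<rparr>) t\<^sub>1" "g w\<^sub>2 \<ge> neval (M\<lparr>nat_val := g\<rparr>) t\<^sub>2"
          "neval (M\<lparr>nat_val := g\<rparr>) (f (NVar w\<^sub>1) (NVar w\<^sub>2)) \<le> g w"
        using 1(2) by simp_all
      \<comment> \<open>Addition and multiplication are monotone in both arguments on the
        naturals.\<close>
      moreover from this(1,2) have "neval (M\<lparr>nat_val := g\<rparr>) (f t\<^sub>1 t\<^sub>2)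
          \<le> neval (M\<lparr>nat_val := g\<rparr>) (f (NVar w\<^sub>1) (NVar w\<^sub>2))"
        using leqAddMul(4) by (auto intro: add_mono mult_mono)
      ultimately show ?case
        using leqAddMul(5) by simp
    qed
  next
    case (leqSub \<gamma> t\<^sub>1 t\<^sub>2 w)
    show ?thesis
      using sat unfolding leqSub(1,4) by (rule satisfiable_replace) auto
  next
    case (leqMod \<gamma> t\<^sub>1 t\<^sub>2 w)
    \<comment> \<open>For \<open>b = 0\<close> this rests on \<open>nat_mod a 0 = 0\<close>; with
      \<open>a mod 0 = a\<close> it would fail.\<close>
    have "nat_mod a b \<le> c" if "b \<le> c" for a b c :: nat
      using le_trans[OF mod_le_divisor[of b a] that] by (cases "b = 0") (simp_all add: nat_mod_def)
    then show ?thesis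
      by (intro satisfiable_replace[OF sat[unfolded leqMod(1,4)]]) auto
  next
    case (leqIf \<gamma> c t\<^sub>1 t\<^sub>2 w w\<^sub>1 w\<^sub>2)
    show ?thesis
      using sat unfolding leqIf(1,4) by (rule satisfiable_replace) auto
  next
    case (ineqHyp \<gamma> r t\<^sub>1 w C)
    show ?thesis
      using sat unfolding ineqHyp(1,4)
    proof (rule satisfiable_instantiate, goal_cases)
      case (3 g)
      then show ?case using hyp[of g, OF _ ineqHyp(7)] by simp
    qed (use ineqHyp in \<open>auto simp: has_vars_def placeholder_def\<close>)
  next
    case (leqZMod \<gamma> p v w)
    have "field_val M p v \<le> int (modulus p) - 1"
      using M by (auto simp: well_sorted_def residue_ring_def)
    then have "nat (field_val M p v) \<le> modulus p - 1" by linarith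
    then show ?thesis
      using leqZMod(5) by (intro satisfiable_instantiate[OF sat[unfolded leqZMod(1,4)]]) auto
  next
    case (leqBV \<gamma> n v w)
    have "bv_to_nat (bv_val M n v) \<le> 2 ^ n - 1"
      using M bv_to_nat_le[of "bv_val M n v"] by (simp add: well_sorted_def)
    then show ?thesis
      using leqBV(5) by (intro satisfiable_instantiate[OF sat[unfolded leqBV(1,4)]]) auto
  next
    case (geNat \<gamma> t\<^sub>1 w)
    show ?thesis
      using geNat(5,6)
      by (intro satisfiable_instantiate[OF sat[unfolded geNat(1,4)]]) (auto simp: has_vars_def placeholder_def)
  next
    case (ineqConst \<gamma> r C w)
    \<comment> \<open>Once \<open>w\<close> has the value of \<open>C\<close>, the goal compares a
      number with itself, and both relations are reflexive.\<close>
    have "rel_holds r a a" for a by (cases r) auto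
    then show ?thesis
      using ineqConst(5,6)
      by (intro satisfiable_instantiate[OF sat[unfolded ineqConst(1,4)]]) (auto simp: const_def)
  next
    case (eval \<gamma> r C\<^sub>1 C\<^sub>2 b)
    \<comment> \<open>Lets \<open>evaluates_to\<close> be applied under the witness
      \<open>g\<close>. If \<open>b\<close> is false, the new goal \<open>BoolConst False\<close>
      contradicts satisfiability.\<close>
    have "well_sorted (M\<lparr>nat_val := g\<rparr>)" for g
      using M by (simp add: well_sorted_def)
    then show ?thesis
      using eval(7)
      by (intro satisfiable_replace[OF sat[unfolded eval(1)]]) (auto simp: evaluates_to_def split: if_splits)
  next
    case (ineqCases \<gamma> r t\<^sub>1 t\<^sub>2 v\<^sub>1 v\<^sub>2)
    show ?thesis
      using sat unfolding ineqCases(1)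
    proof (rule satisfiable_replace, goal_cases)
      case (1 g)
      have "g v\<^sub>1 \<in> {0, 1}" "g v\<^sub>2 \<in> {0, 1}"
        using 1(1) le_one[OF ineqCases(8)] le_one[OF ineqCases(9)] by auto
      \<comment> \<open>Of the four instances, the one substituting the actual values under
        \<open>g\<close> is chosen; this substitution leaves the valuation unchanged.\<close>
      then have "holds (M\<lparr>nat_val := g\<rparr>) (subst (NVar(v\<^sub>1 := NConst (g v\<^sub>1), v\<^sub>2 := NConst (g v\<^sub>2))) \<gamma>)"
        by (intro bspec[OF 1(2)]) blast
      moreover have "(\<lambda>x. neval (M\<lparr>nat_val := g\<rparr>)
          ((NVar(v\<^sub>1 := NConst (g v\<^sub>1), v\<^sub>2 := NConst (g v\<^sub>2))) x)) = g"
        by auto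
      ultimately show ?case
        unfolding eval_subst(4) by simp
    qed
  next
    case (ineqXOR \<gamma> r v\<^sub>1 t\<^sub>1 t\<^sub>2 w)
    show ?thesis
      using sat unfolding ineqXOR(1)
    proof (rule satisfiable_replace, goal_cases)
      case (1 g)
      \<comment> \<open>In either case one summand vanishes and the other is the branch selected by
        the \<open>NIte\<close> term.\<close>
      have "g v\<^sub>1 = 0 \<or> g v\<^sub>1 = 1"
        using 1(1) le_one[OF ineqXOR(6)] by fastforce
      then show ?case
        using 1(2) ineqXOR(4) by auto
    qed
  qed
qed

text \<open>Satisfiability travels from the last goal set to the first, so the induction adds steps
  at the front of the derivation.\<close>

lemma ra_steps_sound:
  assumes "(ra_step V)\<^sup>*\<^sup>* (G, H) (G', H')"
    and "well_sorted M" "\<And>h. h \<in> H \<Longrightarrow> holds M h" "\<And>h. h \<in> H \<Longrightarrow> vars h \<subseteq> V"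
    and "satisfiable V M G'"
  shows "satisfiable V M G"
  using assms
proof (induction rule: converse_rtranclp_induct2)
  case refl
  then show ?case by simp
next
  case (step G\<^sub>1 H\<^sub>1 G\<^sub>2 H\<^sub>2)
  have "H\<^sub>2 = H\<^sub>1" using step.hyps(1) by cases auto
  with step show ?case using ra_step_sound by blast
qed

theorem theorem4:
  fixes G H G' H' :: "form set"
  assumes "is_context (G, H)"
    and "(ra_step (ctxt_vars (G, H)))\<^sup>*\<^sup>* (G, H) (G', H')"
    and "G' = {}"
  shows "\<forall>\<gamma>\<in>G. entails H \<gamma>"
proof
  fix \<gamma> assume "\<gamma> \<in> G"
  have "holds M \<gamma>" if M: "well_sorted M" "\<forall>h\<in>H. holds M h" for M
  proof (rule satisfiable_holds[OF _ \<open>\<gamma> \<in> G\<close>])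
    have "satisfiable (ctxt_vars (G, H)) M G'"
      using assms(3) by (auto simp: satisfiable_def)
    then show "satisfiable (ctxt_vars (G, H)) M G"
      \<comment> \<open>\<open>ctxt_vars\<close> also collects the variables of \<open>H\<close>,
        which gives the inclusion required of the hypotheses.\<close>
      using assms(2) M by (elim ra_steps_sound[rotated -1]) (auto simp: ctxt_vars_def)
    show "vars \<gamma> \<subseteq> ctxt_vars (G, H)"
      using \<open>\<gamma> \<in> G\<close> by (auto simp: ctxt_vars_def)
  qed
  then show "entails H \<gamma>" by (auto simp: entails_def)
qed

end
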